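(* Let $G$ be a weighted graph (not necessarily minimal), let $E_1,\dots,E_m$ be the equivalence classes of $(\theta\cup\tau)^*$ on $E(G)$, let $G_1^*,\dots,G_m^*$ be the graphs constructed from these classes, and let $\alpha:V(G)\to V(\prod_{i=1}^m G_i^* )$ be the map sending each vertex to the tuple of its connected components, all as defined in the context. For $u,v\in V(G)$ with $u\neq v$, $uv\in E(G)$ if and only if $\alpha(u)\alpha(v)\in E(\prod_i G_i^* )$, and if these are edges they have the same weight. Thus $\{G_1^*,\dots,G_m^*\}$ is a factorization of $G$, i.e. $G$ is isomorphic to $\prod_{i=1}^m G_i^*$.
   Context: Graphs are finite, connected, undirected weighted graphs $G=(V,E,w)$ with $w:E\to\mathbb{R}_{>0}$; $d_G$ denotes the shortest-path metric (minimum total edge weight of a path). An isomorphism of weighted graphs is a bijection of vertices preserving adjacency, non-adjacency and edge weights. Cartesian product: for $G_i=(V_i,E_i,w_i)$, $1\le i\le m$, the graph $\prod_{i=1}^m G_i$ has vertex set $V_1\times\cdots\times V_m$; $(u_1,\dots,u_m)(v_1,\dots,v_m)$ is an edge iff there is exactly one index $\ell$ with $u_\ell v_\ell\in E_\ell$ and $u_i=v_i$ for all $i\ne\ell$, and its weight is then $w_\ell(u_\ell v_\ell)$. The empty product is read as the one-vertex graph $K_1$. Relations: edges $uv,ab\in E(G)$ satisfy $uv\,\theta\,ab$ iff $[d_G(u,a)-d_G(u,b)]-[d_G(v,a)-d_G(v,b)]\neq 0$. Edges $uv,uv'\in E(G)$ satisfy the square property if there is a vertex $x$ such that $u,v,x,v'$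 form a four-cycle (edges $uv,vx,xv',v'u$) with $w_G(uv)=w_G(xv')$, $w_G(uv')=w_G(xv)$, $uv\,\theta\,xv'$ and $uv'\,\theta\,xv$. Two edges $uv,uv'$ sharing an endpoint satisfy $uv\,\tau\,uv'$ iff they do not satisfy the square property; edges without a common endpoint are not related by $\tau$. $(\theta\cup\tau)^*$ is the transitive closure of $\theta\cup\tau$; it is an equivalence relation on $E(G)$. Construction: for each class $E_k$, let $G_k'$ be $G$ with the edges of $E_k$ deleted, with connected components $C_1,\dots,C_\ell$. The graph $G_k^*$ has one vertex $a$ for each component $C_a$; $ab$ is an edge iff some edge of $E_k$ joins $C_a$ and $C_b$, and its weight is the common weight of all edges of $G$ between $C_a$ and $C_b$ (for the relation $(\theta\cup\tau)^*$ such a common weight always exists). The map is $\alpha(u)=(\alpha_1(u),\dots,\alpha_m(u))$ where $\alpha_i(u)$ is the vertex of $G_i^*$ corresponding to the component of $G_i'$ containing $u$. *)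

theory Defs
  imports Complex_Main "HOL-Library.FuncSet"
begin

text \<open>
  Edges are two-element vertex sets, so graphs are simple and undirected. Only the values
  of \<open>weight\<close> on edges are meaningful.
\<close>

record 'a wgraph =
  verts :: "'a set"
  edges :: "'a set set"
  weight :: "'a set \<Rightarrow> real"

definition path_between :: "'a wgraph \<Rightarrow> 'a \<Rightarrow> 'a list \<Rightarrow> 'a \<Rightarrow> bool" where
  "path_between G u p v \<longleftrightarrow>
     p \<noteq> [] \<and> hd p = u \<and> last p = v \<and> distinct p \<and> set p \<subseteq> verts G \<and>
     successively (\<lambda>x y. {x, y} \<in> edges G) p"

definition path_weight :: "'a wgraph \<Rightarrow> 'a list \<Rightarrow> real" where
  "path_weight G p = (\<Sum>(x, y) \<leftarrow> zip p (tl p). weight G {x, y})"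

text \<open>
  The vertex set is required to be nonempty: the empty product is \<open>K\<^sub>1\<close>, so the graph
  without vertices is excluded.
\<close>

definition weighted_graph :: "'a wgraph \<Rightarrow> bool" where
  "weighted_graph G \<longleftrightarrow>
     finite (verts G) \<and> verts G \<noteq> {} \<and>
     (\<forall>e\<in>edges G. \<exists>u\<in>verts G. \<exists>v\<in>verts G. u \<noteq> v \<and> e = {u, v}) \<and>
     (\<forall>e\<in>edges G. weight G e > 0) \<and>
     (\<forall>u\<in>verts G. \<forall>v\<in>verts G. \<exists>p. path_between G u p v)"

text \<open>
  Paths have distinct vertices, so in a finite connected graph the minimum is over a finite
  nonempty set. An edge need not be a shortest path between its endpoints.
\<close>

definition gdist :: "'a wgraph \<Rightarrow> 'a \<Rightarrow> 'a \<Rightarrow> real" where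
  "gdist G u v = Min {path_weight G p |p. path_between G u p v}"

definition is_iso :: "('a \<Rightarrow> 'b) \<Rightarrow> 'a wgraph \<Rightarrow> 'b wgraph \<Rightarrow> bool" where
  "is_iso f G H \<longleftrightarrow>
     bij_betw f (verts G) (verts H) \<and>
     (\<forall>u\<in>verts G. \<forall>v\<in>verts G.
        ({u, v} \<in> edges G \<longleftrightarrow> {f u, f v} \<in> edges H) \<and>
        ({u, v} \<in> edges G \<longrightarrow> weight G {u, v} = weight H {f u, f v}))"

definition isomorphic :: "'a wgraph \<Rightarrow> 'b wgraph \<Rightarrow> bool" where
  "isomorphic G H \<longleftrightarrow> (\<exists>f. is_iso f G H)"

text \<open>
  Tuples are extensional functions on the index set \<open>I\<close>; for \<open>I = {}\<close> there is exactly one,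
  so the empty product is \<open>K\<^sub>1\<close>.
\<close>

definition product_step :: "'i set \<Rightarrow> ('i \<Rightarrow> 'b wgraph) \<Rightarrow> ('i \<Rightarrow> 'b) \<Rightarrow> ('i \<Rightarrow> 'b) \<Rightarrow> 'i \<Rightarrow> bool" where
  "product_step I H u v l \<longleftrightarrow>
     l \<in> I \<and> {u l, v l} \<in> edges (H l) \<and> (\<forall>i\<in>I. i \<noteq> l \<longrightarrow> u i = v i)"

definition cart_prod :: "'i set \<Rightarrow> ('i \<Rightarrow> 'b wgraph) \<Rightarrow> ('i \<Rightarrow> 'b) wgraph" where
  "cart_prod I H =
     \<lparr> verts = (\<Pi>\<^sub>E i\<in>I. verts (H i)),
       edges = {{u, v} |u v. u \<in> (\<Pi>\<^sub>E i\<in>I. verts (H i)) \<and> v \<in> (\<Pi>\<^sub>E i\<in>I. verts (H i)) \<and>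
                             (\<exists>!l. product_step I H u v l)},
       weight = (\<lambda>e. THE c. \<exists>u v l. e = {u, v} \<and> product_step I H u v l \<and>
                                    c = weight (H l) {u l, v l}) \<rparr>"

lemma weight_cart_prod:
  assumes "product_step I H u v l" and "\<And>i. i \<in> I \<Longrightarrow> weighted_graph (H i)"
  shows "weight (cart_prod I H) {u, v} = weight (H l) {u l, v l}"
proof -
  have no_loop: "a \<noteq> b" if "i \<in> I" "{a, b} \<in> edges (H i)" for i a b
    using assms(2)[OF that(1)] that(2) unfolding weighted_graph_def
    by (metis doubleton_eq_iff)
  have same: "l' = l" if "product_step I H u v l'" for l'
    using that assms(1) no_loop unfolding product_step_def by metis
  have swap: "product_step I H y x l'" if "product_step I H x y l'" for x y l'
    using that unfolding product_step_def by (metis insert_commute)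
  show ?thesis
    unfolding cart_prod_def wgraph.simps
  proof (rule the_equality)
    show "\<exists>u' v' l'. {u, v} = {u', v'} \<and> product_step I H u' v' l' \<and>
                     weight (H l) {u l, v l} = weight (H l') {u' l', v' l'}"
      using assms(1) by blast
  next
    fix c
    assume "\<exists>u' v' l'. {u, v} = {u', v'} \<and> product_step I H u' v' l' \<and>
                       c = weight (H l') {u' l', v' l'}"
    then obtain u' v' l' where *: "{u, v} = {u', v'}" "product_step I H u' v' l'"
      "c = weight (H l') {u' l', v' l'}" by blast
    have "(u' = u \<and> v' = v) \<or> (u' = v \<and> v' = u)" using *(1) by (metis doubleton_eq_iff)
    then show "c = weight (H l) {u l, v l}"
      using *(2,3) same swap by (metis insert_commute)
  qed
qed

definition factorization :: "'i set \<Rightarrow> ('i \<Rightarrow> 'b wgraph) \<Rightarrow> 'a wgraph \<Rightarrow> bool" where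
  "factorization I H G \<longleftrightarrow>
     (\<forall>i\<in>I. weighted_graph (H i)) \<and> isomorphic G (cart_prod I H)"

text \<open>The condition does not depend on how the endpoints of the two edges are named.\<close>

definition theta :: "'a wgraph \<Rightarrow> ('a set \<times> 'a set) set" where
  "theta G = {({u, v}, {a, b}) |u v a b. {u, v} \<in> edges G \<and> {a, b} \<in> edges G \<and>
     (gdist G u a - gdist G u b) - (gdist G v a - gdist G v b) \<noteq> 0}"

definition square_property :: "'a wgraph \<Rightarrow> 'a \<Rightarrow> 'a \<Rightarrow> 'a \<Rightarrow> bool" where
  "square_property G u v v' \<longleftrightarrow>
     (\<exists>x. distinct [u, v, x, v'] \<and>
          {u, v} \<in> edges G \<and> {v, x} \<in> edges G \<and> {x, v'} \<in> edges G \<and> {v', u} \<in> edges G \<and>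
          weight G {u, v} = weight G {x, v'} \<and> weight G {u, v'} = weight G {x, v} \<and>
          ({u, v}, {x, v'}) \<in> theta G \<and> ({u, v'}, {x, v}) \<in> theta G)"

definition tau :: "'a wgraph \<Rightarrow> ('a set \<times> 'a set) set" where
  "tau G = {({u, v}, {u, v'}) |u v v'. {u, v} \<in> edges G \<and> {u, v'} \<in> edges G \<and>
     \<not> square_property G u v v'}"

definition theta_tau_star :: "'a wgraph \<Rightarrow> ('a set \<times> 'a set) set" where
  "theta_tau_star G = (theta G \<union> tau G)\<^sup>+"

definition delete_edges :: "'a wgraph \<Rightarrow> 'a set set \<Rightarrow> 'a wgraph" where
  "delete_edges G F = G\<lparr>edges := edges G - F\<rparr>"

definition component_of :: "'a wgraph \<Rightarrow> 'a \<Rightarrow> 'a set" where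
  "component_of G u = {v \<in> verts G. \<exists>p. path_between G u p v}"

definition components :: "'a wgraph \<Rightarrow> 'a set set" where
  "components G = component_of G ` verts G"

text \<open>
  The graph \<open>G\<^sub>k\<^sup>*\<close> for the class \<open>F = E\<^sub>k\<close>; its vertices are the components themselves. The
  weight of an edge is the common weight of all edges of \<open>G\<close> between the two components, and
  is unspecified if these weights differ.
\<close>

definition quotient_graph :: "'a wgraph \<Rightarrow> 'a set set \<Rightarrow> 'a set wgraph" where
  "quotient_graph G F =
     \<lparr> verts = components (delete_edges G F),
       edges = {{A, B} |A B. A \<in> components (delete_edges G F) \<and>
                             B \<in> components (delete_edges G F) \<and> A \<noteq> B \<and>
                             (\<exists>a\<in>A. \<exists>b\<in>B. {a, b} \<in> F)},
       weight = (\<lambda>e. THE c. \<forall>A B. e = {A, B} \<longrightarrow>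
                   (\<forall>a\<in>A. \<forall>b\<in>B. {a, b} \<in> edges G \<longrightarrow> weight G {a, b} = c)) \<rparr>"

definition alpha :: "'a wgraph \<Rightarrow> nat \<Rightarrow> (nat \<Rightarrow> 'a set set) \<Rightarrow> 'a \<Rightarrow> (nat \<Rightarrow> 'a set)" where
  "alpha G m E u = (\<lambda>i\<in>{1..m}. component_of (delete_edges G (E i)) u)"

end

theory Submission
  imports Defs
begin

text \<open>
  Write \<open>K\<^sub>i\<close> for the connectivity relation of \<open>G\<close> without the class \<open>E\<^sub>i\<close>. For an edge \<open>ab\<close> put
  \<open>f\<^sub>a\<^sub>b x = d(x, a) - d(x, b)\<close>; an edge \<open>xy\<close> is \<open>\<theta>\<close>-related to \<open>ab\<close> iff \<open>f\<^sub>a\<^sub>b x \<noteq> f\<^sub>a\<^sub>b y\<close>, so a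
  walk from \<open>u\<close> to \<open>v\<close> with \<open>f\<^sub>a\<^sub>b u \<noteq> f\<^sub>a\<^sub>b v\<close> must use the class of \<open>ab\<close>. Taking \<open>ab = uv\<close>, the ends
  of an edge of \<open>E\<^sub>i\<close> are separated by \<open>K\<^sub>i\<close>. If \<open>f\<^sub>a\<^sub>b u = f\<^sub>a\<^sub>b v\<close> held for all edges \<open>ab\<close>, then
  \<open>d(u, a) - d(v, a)\<close> would be constant in \<open>a\<close>, forcing \<open>d(u, v) = 0\<close>; so distinct vertices are
  separated by some \<open>K\<^sub>i\<close>, and \<open>\<alpha>\<close> is injective.

  Edges \<open>uv\<close> and \<open>uv'\<close> of different classes are not \<open>\<tau>\<close>-related, so they span a square with opposite
  edges in the same class and of equal weight. Hence steps in \<open>E\<^sub>k\<close> can be moved to the front of any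
  walk, which gives surjectivity, and an edge of \<open>E\<^sub>k\<close> can be transported along \<open>K\<^sub>k\<close> without
  changing its weight, which gives the converse for edges and the well-definedness of weights.
\<close>

section \<open>Paths and walks\<close>

text \<open>Indexed by an edge set rather than a graph, so that walks in \<open>G\<close>, inside
  one class and outside one class are all reflexive transitive closures of the same
  construction.\<close>

definition adj :: "'a set set \<Rightarrow> ('a \<times> 'a) set" where
  "adj F = {(x, y). {x, y} \<in> F}"

lemma adj_iff [simp]: "(x, y) \<in> adj F \<longleftrightarrow> {x, y} \<in> F"
  by (simp add: adj_def)

lemma sym_adj_rtrancl: "sym ((adj F)\<^sup>*)"
  by (intro sym_rtrancl symI) (simp add: insert_commute)

lemma adj_rtrancl_sym: "(x, y) \<in> (adj F)\<^sup>* \<Longrightarrow> (y, x) \<in> (adj F)\<^sup>*"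
  using sym_adj_rtrancl by (rule symD)

lemma path_between_imp_rtrancl:
  assumes "path_between H u p v"
  shows "(u, v) \<in> (adj (edges H))\<^sup>*"
  using assms
proof (induction p arbitrary: u)
  case Nil
  then show ?case by (simp add: path_between_def)
next
  case (Cons x p)
  show ?case
  proof (cases p)
    case Nil
    with Cons.prems show ?thesis by (auto simp: path_between_def)
  next
    case (Cons y q)
    have "path_between H y p v" "u = x" "{x, y} \<in> edges H"
      using Cons.prems Cons by (auto simp: path_between_def)
    then show ?thesis
      using Cons.IH by (auto intro: converse_rtrancl_into_rtrancl)
  qed
qed

lemma path_between_prefix:
  assumes "path_between H u p v" "w \<in> set p"
  shows "\<exists>q. path_between H u q w"
proof -
  obtain ys zs where p: "p = ys @ w # zs"
    using assms(2) by (meson split_list)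
  have "path_between H u (ys @ [w]) w"
    using assms(1) unfolding p path_between_def
    by (auto simp: successively_append_iff hd_append)
  then show ?thesis by blast
qed

text \<open>A path is extended edge by edge along the walk. If the next vertex already occurs on it,
  the path is cut there, which keeps its vertices distinct.\<close>

lemma rtrancl_imp_path_between:
  assumes "(u, v) \<in> (adj (edges H))\<^sup>*" "u \<in> verts H" "\<Union>(edges H) \<subseteq> verts H"
  shows "\<exists>p. path_between H u p v"
  using assms(1)
proof induction
  case base
  have "path_between H u [u] u"
    using assms(2) by (simp add: path_between_def)
  then show ?case by blast
next
  case (step y z)
  then obtain p where p: "path_between H u p y" by blast
  show ?case
  proof (cases "z \<in> set p")
    case True
    with p show ?thesis by (rule path_between_prefix)
  next
    case False
    have "z \<in> verts H" using step.hyps(2) assms(3) by auto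
    then have "path_between H u (p @ [z]) z"
      using p False step.hyps(2)
      by (auto simp: path_between_def successively_append_iff)
    then show ?thesis by blast
  qed
qed

lemma path_between_iff:
  assumes "u \<in> verts H" "\<Union>(edges H) \<subseteq> verts H"
  shows "(\<exists>p. path_between H u p v) \<longleftrightarrow> (u, v) \<in> (adj (edges H))\<^sup>*"
  using assms path_between_imp_rtrancl rtrancl_imp_path_between by metis

lemma path_between_rev:
  assumes "path_between G u p v"
  shows "path_between G v (rev p) u"
  using assms by (auto simp: path_between_def hd_rev last_rev insert_commute)

lemma path_weight_simps [simp]:
  "path_weight G [] = 0"
  "path_weight G [x] = 0"
  "path_weight G (x # y # p) = weight G {x, y} + path_weight G (y # p)"
  by (simp_all add: path_weight_def)

lemma path_weight_snoc:
  "path_weight G (p @ [x, y]) = path_weight G (p @ [x]) + weight G {x, y}"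
  by (induction p rule: induct_list012) simp_all

lemma path_weight_rev: "path_weight G (rev p) = path_weight G p"
  by (induction p rule: induct_list012) (simp_all add: path_weight_snoc insert_commute)

lemma path_weight_nonneg:
  assumes "\<forall>e\<in>edges G. weight G e > 0" "successively (\<lambda>x y. {x, y} \<in> edges G) p"
  shows "path_weight G p \<ge> 0"
  using assms(2)
  by (induction p rule: induct_list012) (auto dest!: bspec[OF assms(1)])

section \<open>The distance function\<close>

lemma gdist_commute: "gdist G u v = gdist G v u"
proof -
  have "{path_weight G p |p. path_between G a p b} \<subseteq> {path_weight G p |p. path_between G b p a}"
    for a b
    by clarsimp (metis path_between_rev path_weight_rev)
  then show ?thesis unfolding gdist_def by (metis (lifting) subset_antisym)
qed

lemma gdist_refl:
  assumes "u \<in> verts G"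
  shows "gdist G u u = 0"
proof -
  have "path_between G u p u \<longleftrightarrow> p = [u]" for p
    using assms by (cases p) (auto simp: path_between_def split: if_splits)
  then show ?thesis by (simp add: gdist_def)
qed

locale wgraph =
  fixes G :: "'a wgraph"
  assumes wg: "weighted_graph G"
begin

lemma edge_verts:
  assumes "{u, v} \<in> edges G"
  shows "u \<in> verts G" "v \<in> verts G" "u \<noteq> v"
proof -
  obtain x y where "x \<in> verts G" "y \<in> verts G" "x \<noteq> y" "{u, v} = {x, y}"
    using wg assms unfolding weighted_graph_def by metis
  then show "u \<in> verts G" "v \<in> verts G" "u \<noteq> v"
    by (auto simp: doubleton_eq_iff)
qed

lemma edge_cases:
  assumes "e \<in> edges G"
  obtains u v where "e = {u, v}" "{u, v} \<in> edges G"
  using wg assms unfolding weighted_graph_def by metis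

lemma edges_within_verts: "\<Union>(edges G) \<subseteq> verts G"
  using wg unfolding weighted_graph_def by fastforce

lemma gdist_pos:
  assumes "u \<in> verts G" "v \<in> verts G" "u \<noteq> v"
  shows "gdist G u v > 0"
proof -
  have pos: "path_weight G p > 0" if p: "path_between G u p v" for p
  proof -
    obtain y q where q: "p = u # y # q"
      using p assms(3) unfolding path_between_def
      by (cases p rule: remdups_adj.cases) auto
    have "path_weight G (y # q) \<ge> 0"
      using p wg q
      by (intro path_weight_nonneg) (auto simp: path_between_def weighted_graph_def)
    moreover have "weight G {u, y} > 0"
      using p wg q by (auto simp: path_between_def weighted_graph_def)
    ultimately show ?thesis using q by simp
  qed
  \<comment> \<open>\<open>Min\<close> carries information only for a finite nonempty set;
    distinctness of the vertices bounds the number of paths.\<close>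
  have "{p. path_between G u p v} \<subseteq> {p. set p \<subseteq> verts G \<and> distinct p}"
    by (auto simp: path_between_def)
  moreover have "finite {p. set p \<subseteq> verts G \<and> distinct p}"
    using wg by (intro finite_subset_distinct) (simp add: weighted_graph_def)
  ultimately have "finite {p. path_between G u p v}"
    by (rule finite_subset)
  moreover have "{p. path_between G u p v} \<noteq> {}"
    using wg assms by (auto simp: weighted_graph_def)
  ultimately show ?thesis
    unfolding gdist_def using pos by (subst Min_gr_iff) (auto simp: setcompr_eq_image)
qed

lemma walk_connected:
  assumes "u \<in> verts G" "v \<in> verts G"
  shows "(u, v) \<in> (adj (edges G))\<^sup>*"
  using wg assms path_between_imp_rtrancl unfolding weighted_graph_def by metis

section \<open>The equivalence relation and the squares\<close>

text \<open>The two sides are -d(u, v) and d(u, v), and d(u, v) is positive. This yields both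
  reflexivity of \<open>theta\<close> on edges and the separation of the ends of an edge by its
  class.\<close>

lemma theta_refl:
  assumes "{u, v} \<in> edges G"
  shows "gdist G u u - gdist G u v \<noteq> gdist G v u - gdist G v v"
  using gdist_pos[OF edge_verts[OF assms]] edge_verts[OF assms]
  by (simp add: gdist_refl gdist_commute[of G v u])

lemma theta_tau_star_refl:
  assumes "e \<in> edges G"
  shows "(e, e) \<in> theta_tau_star G"
proof -
  obtain u v where "e = {u, v}" "{u, v} \<in> edges G" using assms by (rule edge_cases)
  then have "(e, e) \<in> theta G"
    using theta_refl unfolding theta_def by fastforce
  then show ?thesis by (auto simp: theta_tau_star_def)
qed

lemma sym_theta: "sym (theta G)"
proof (rule symI)
  fix e f assume "(e, f) \<in> theta G"
  then obtain u v a b where *: "e = {u, v}" "f = {a, b}" "{u, v} \<in> edges G" "{a, b} \<in> edges G"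
    "(gdist G u a - gdist G u b) - (gdist G v a - gdist G v b) \<noteq> 0"
    unfolding theta_def by blast
  then have "(gdist G a u - gdist G a v) - (gdist G b u - gdist G b v) \<noteq> 0"
    by (simp add: gdist_commute[of G u] gdist_commute[of G v])
  with * show "(f, e) \<in> theta G" unfolding theta_def by blast
qed

lemma sym_tau: "sym (tau G)"
proof -
  have "square_property G u v v'" if "square_property G u v' v" for u v v'
    using that unfolding square_property_def by (auto simp: insert_commute)
  then show ?thesis unfolding tau_def sym_def by blast
qed

lemma equiv_theta_tau_star: "equiv (edges G) (theta_tau_star G)"
proof (rule equivI)
  have "theta G \<union> tau G \<subseteq> edges G \<times> edges G"
    by (auto simp: theta_def tau_def)
  then show "theta_tau_star G \<subseteq> edges G \<times> edges G"
    unfolding theta_tau_star_def by (rule trancl_subset_Sigma)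
  show "refl_on (edges G) (theta_tau_star G)"
    using theta_tau_star_refl by (auto simp: refl_on_def)
  show "sym (theta_tau_star G)"
    unfolding theta_tau_star_def by (intro sym_trancl sym_Un sym_theta sym_tau)
  show "trans (theta_tau_star G)"
    by (simp add: theta_tau_star_def)
qed

lemma theta_separates:
  assumes F: "F \<in> edges G // theta_tau_star G" and ab: "{a, b} \<in> F"
    and neq: "gdist G u a - gdist G u b \<noteq> gdist G v a - gdist G v b"
  shows "(u, v) \<notin> (adj (edges G - F))\<^sup>*"
proof
  assume "(u, v) \<in> (adj (edges G - F))\<^sup>*"
  then have "gdist G u a - gdist G u b = gdist G v a - gdist G v b"
  proof induction
    case base
    show ?case by simp
  next
    case (step y z)
    have abG: "{a, b} \<in> edges G"
      using F ab equiv_theta_tau_star by (meson in_quotient_imp_subset subsetD)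
    have yz: "{y, z} \<in> edges G" "{y, z} \<notin> F" using step.hyps by auto
    \<comment> \<open>Otherwise \<open>{y, z}\<close> would lie in the class \<open>F\<close> of
      \<open>{a, b}\<close>, but the walk avoids \<open>F\<close>.\<close>
    have "({y, z}, {a, b}) \<notin> theta G"
    proof
      assume "({y, z}, {a, b}) \<in> theta G"
      then have "({a, b}, {y, z}) \<in> theta_tau_star G"
        using symD[OF sym_theta] by (auto simp: theta_tau_star_def)
      with F ab yz show False
        using equiv_theta_tau_star by (meson in_quotient_imp_closed)
    qed
    then have "gdist G y a - gdist G y b = gdist G z a - gdist G z b"
      using abG yz unfolding theta_def by auto
    with step.IH show ?case by simp
  qed
  with neq show False by simp
qed

lemma distinct_verts_separated:
  assumes "u \<in> verts G" "v \<in> verts G" "u \<noteq> v"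
  obtains a b where "{a, b} \<in> edges G"
    "gdist G u a - gdist G u b \<noteq> gdist G v a - gdist G v b"
proof (rule ccontr)
  assume "\<not> thesis"
  with that have edge_eq: "gdist G u a - gdist G u b = gdist G v a - gdist G v b"
    if "{a, b} \<in> edges G" for a b
    using that by blast
  have "gdist G u u - gdist G v u = gdist G u c - gdist G v c"
    if "(u, c) \<in> (adj (edges G))\<^sup>*" for c
    using that
  proof induction
    case base
    show ?case by simp
  next
    case (step y z)
    then have "gdist G u y - gdist G u z = gdist G v y - gdist G v z"
      using edge_eq[of y z] by simp
    with step.IH show ?case by simp
  qed
  \<comment> \<open>For c = v the equation reads -d(u, v) = d(u, v).\<close>
  from this[OF walk_connected[OF assms(1,2)]] have "gdist G u v = 0"
    using assms by (simp add: gdist_refl gdist_commute[of G v u])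
  with gdist_pos[OF assms] show False by simp
qed

text \<open>Edges at \<open>u\<close> from different classes cannot be \<open>tau\<close>-related,
  so they span a square. The two \<open>theta\<close> conditions of the square property put opposite
  sides into the same class.\<close>

lemma class_square:
  assumes F: "F \<in> edges G // theta_tau_star G" and H: "H \<in> edges G // theta_tau_star G"
    and "F \<noteq> H" "{u, v} \<in> F" "{u, v'} \<in> H"
  obtains x where "{v, x} \<in> H" "{x, v'} \<in> F" "weight G {u, v} = weight G {x, v'}"
proof -
  note eq = equiv_theta_tau_star
  have e: "{u, v} \<in> edges G" "{u, v'} \<in> edges G"
    using assms eq by (meson in_quotient_imp_subset subsetD)+
  have "({u, v}, {u, v'}) \<notin> theta_tau_star G"
    using assms eq by (metis quotient_eqI)
  then have "({u, v}, {u, v'}) \<notin> tau G"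
    by (auto simp: theta_tau_star_def)
  then have "square_property G u v v'"
    using e unfolding tau_def by blast
  then obtain x where x: "weight G {u, v} = weight G {x, v'}"
    "({u, v}, {x, v'}) \<in> theta G" "({u, v'}, {x, v}) \<in> theta G"
    unfolding square_property_def by blast
  then have "({u, v}, {x, v'}) \<in> theta_tau_star G" "({u, v'}, {x, v}) \<in> theta_tau_star G"
    by (auto simp: theta_tau_star_def)
  then have "{x, v'} \<in> F" "{x, v} \<in> H"
    using assms(4,5) in_quotient_imp_closed[OF eq] F H by metis+
  with x that show thesis by (simp add: insert_commute)
qed

end

section \<open>Partitions of the edges with the square property\<close>

text \<open>Isolates what the factorization needs from the classes. Inside this locale
  \<open>theta\<close>, \<open>tau\<close> and distances no longer occur, and all arguments concern
  walks and squares.\<close>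

locale square_partition = wgraph G for G :: "'a wgraph" +
  fixes m :: nat and E :: "nat \<Rightarrow> 'a set set"
  assumes class_sub: "i \<in> {1..m} \<Longrightarrow> E i \<subseteq> edges G"
    and class_cover: "e \<in> edges G \<Longrightarrow> \<exists>i\<in>{1..m}. e \<in> E i"
    and class_disjoint: "\<lbrakk>i \<in> {1..m}; j \<in> {1..m}; i \<noteq> j; e \<in> E i\<rbrakk> \<Longrightarrow> e \<notin> E j"
    and square: "\<lbrakk>i \<in> {1..m}; j \<in> {1..m}; i \<noteq> j; {u, v} \<in> E i; {u, v'} \<in> E j\<rbrakk> \<Longrightarrow>
      \<exists>x. {v, x} \<in> E j \<and> {x, v'} \<in> E i \<and> weight G {u, v} = weight G {x, v'}"
    and class_separates: "\<lbrakk>i \<in> {1..m}; {u, v} \<in> E i\<rbrakk> \<Longrightarrow> (u, v) \<notin> (adj (edges G - E i))\<^sup>*"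
    and verts_separated: "\<lbrakk>u \<in> verts G; v \<in> verts G; u \<noteq> v\<rbrakk> \<Longrightarrow>
      \<exists>i\<in>{1..m}. (u, v) \<notin> (adj (edges G - E i))\<^sup>*"
begin

text \<open>This is the relation \<open>K\<^sub>i\<close> of the overview. Restricted to
  \<open>verts G\<close>, its classes are the components after deleting \<open>E i\<close>.\<close>

definition conn :: "nat \<Rightarrow> ('a \<times> 'a) set" where
  "conn i = (adj (edges G - E i))\<^sup>*"

abbreviation comp :: "nat \<Rightarrow> 'a \<Rightarrow> 'a set" where
  "comp i u \<equiv> component_of (delete_edges G (E i)) u"

abbreviation Q :: "nat \<Rightarrow> 'a set wgraph" where
  "Q i \<equiv> quotient_graph G (E i)"

section \<open>Connectivity outside a class\<close>

lemma conn_refl [simp]: "(u, u) \<in> conn i"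
  by (simp add: conn_def)

lemma conn_sym: "(u, v) \<in> conn i \<Longrightarrow> (v, u) \<in> conn i"
  unfolding conn_def by (rule adj_rtrancl_sym)

lemma conn_trans: "(u, v) \<in> conn i \<Longrightarrow> (v, w) \<in> conn i \<Longrightarrow> (u, w) \<in> conn i"
  unfolding conn_def by (rule rtrancl_trans)

lemma conn_edge: "{u, v} \<in> edges G \<Longrightarrow> {u, v} \<notin> E i \<Longrightarrow> (u, v) \<in> conn i"
  unfolding conn_def by auto

lemma class_edge: "i \<in> {1..m} \<Longrightarrow> e \<in> E i \<Longrightarrow> e \<in> edges G"
  using class_sub by blast

lemma conn_class:
  assumes "i \<in> {1..m}" "j \<in> {1..m}" "i \<noteq> j" "{u, v} \<in> E j"
  shows "(u, v) \<in> conn i"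
  using conn_edge class_edge[OF assms(2,4)] class_disjoint[OF assms(2,1) _ assms(4)] assms(3)
  by blast

lemma conn_all_eq:
  assumes "u \<in> verts G" "v \<in> verts G" "\<And>i. i \<in> {1..m} \<Longrightarrow> (u, v) \<in> conn i"
  shows "u = v"
  using assms verts_separated unfolding conn_def by blast

lemma component_eq:
  assumes "u \<in> verts G"
  shows "comp i u = {v \<in> verts G. (u, v) \<in> conn i}"
  using assms edges_within_verts unfolding component_of_def conn_def
  by (subst path_between_iff) (auto simp: delete_edges_def)

lemma component_eq_iff:
  assumes "u \<in> verts G" "v \<in> verts G"
  shows "comp i u = comp i v \<longleftrightarrow> (u, v) \<in> conn i"
proof
  assume "comp i u = comp i v"
  moreover have "v \<in> comp i v" using assms(2) by (simp add: component_eq)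
  ultimately have "v \<in> comp i u" by simp
  then show "(u, v) \<in> conn i" using assms(1) by (simp add: component_eq)
next
  assume "(u, v) \<in> conn i"
  then have "(u, w) \<in> conn i \<longleftrightarrow> (v, w) \<in> conn i" for w
    using conn_sym conn_trans by blast
  then show "comp i u = comp i v" using assms by (simp add: component_eq)
qed

lemma verts_Q: "verts (Q i) = comp i ` verts G"
  by (simp add: quotient_graph_def components_def delete_edges_def)

text \<open>A walk from \<open>u\<close> to \<open>v\<close> is rearranged so that its steps in
  \<open>E k\<close> come first. The turning point \<open>x\<close> then shares the k-th component
  with \<open>v\<close> and all other components with \<open>u\<close>.\<close>

lemma class_front:
  assumes k: "k \<in> {1..m}" and uv: "u \<in> verts G" "v \<in> verts G"
  obtains x where "(u, x) \<in> (adj (E k))\<^sup>*" "(x, v) \<in> conn k"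
proof -
  \<comment> \<open>The edges from \<open>y\<close> to \<open>x\<close> and to \<open>z\<close> lie
    in different classes; going round the other side of their square exchanges the order of the two
    steps.\<close>
  have swap1: "\<exists>q. (x, q) \<in> adj (E k) \<and> (q, z) \<in> adj (edges G - E k)"
    if xy: "(x, y) \<in> adj (edges G - E k)" and yz: "(y, z) \<in> adj (E k)" for x y z
  proof -
    have xy': "{y, x} \<in> edges G" "{y, x} \<notin> E k"
      using xy by (simp_all add: insert_commute)
    then obtain j where j: "j \<in> {1..m}" "{y, x} \<in> E j" "j \<noteq> k"
      using class_cover by metis
    then obtain q where "{x, q} \<in> E k" "{q, z} \<in> E j"
      using square[of j k y x z] k yz by auto
    moreover from this have "{q, z} \<in> edges G - E k"
      using j k class_disjoint class_edge by blast
    ultimately show ?thesis by auto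
  qed
  \<comment> \<open>The step in \<open>E k\<close> passes the last edge of the walk by
    \<open>swap1\<close>, and the rest by the induction hypothesis.\<close>
  have swap: "\<exists>q. (x, q) \<in> adj (E k) \<and> (q, z) \<in> conn k"
    if "(x, y) \<in> conn k" "(y, z) \<in> adj (E k)" for x y z
    using that unfolding conn_def
  proof (induction arbitrary: z)
    case base
    then show ?case by blast
  next
    case (step y' y)
    obtain q where "(y', q) \<in> adj (E k)" "(q, z) \<in> adj (edges G - E k)"
      using swap1[OF step.hyps(2) step.prems] by blast
    then show ?case using step.IH by (meson rtrancl.rtrancl_into_rtrancl)
  qed
  have "\<exists>x. (u, x) \<in> (adj (E k))\<^sup>* \<and> (x, v) \<in> conn k"
    using walk_connected[OF uv]
  proof induction
    case base
    show ?case using conn_refl by blast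
  next
    case (step y z)
    then obtain x where x: "(u, x) \<in> (adj (E k))\<^sup>*" "(x, y) \<in> conn k" by blast
    show ?case
    proof (cases "{y, z} \<in> E k")
      case True
      then show ?thesis
        using swap[of x y z] x by (metis adj_iff rtrancl.rtrancl_into_rtrancl)
    next
      case False
      then show ?thesis
        using conn_edge conn_trans x step.hyps(2) by (metis adj_iff)
    qed
  qed
  with that show thesis by blast
qed

lemma walk_in_verts:
  assumes "k \<in> {1..m}" "(u, x) \<in> (adj (E k))\<^sup>*" "u \<in> verts G"
  shows "x \<in> verts G"
  using assms(2,3) by induction (auto dest: class_edge[OF assms(1)] edge_verts)

lemma class_walk_conn:
  assumes "k \<in> {1..m}" "i \<in> {1..m}" "i \<noteq> k" "(u, x) \<in> (adj (E k))\<^sup>*"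
  shows "(u, x) \<in> conn i"
  using assms(4)
proof induction
  case base
  show ?case by simp
next
  case (step y z)
  then have "(y, z) \<in> conn i" using conn_class[OF assms(2,1,3)] by simp
  with step.IH show ?case by (rule conn_trans)
qed

text \<open>Surjectivity of \<open>alpha\<close>: the components are prescribed one index at a time.
  Correcting the k-th one by a walk inside \<open>E k\<close> leaves those already prescribed
  unchanged.\<close>

lemma vertex_with_components:
  assumes f: "\<And>i. i \<in> {1..m} \<Longrightarrow> f i \<in> verts (Q i)"
  obtains u where "u \<in> verts G" "\<And>i. i \<in> {1..m} \<Longrightarrow> comp i u = f i"
proof -
  have "\<exists>u\<in>verts G. \<forall>i\<in>J. comp i u = f i" if "finite J" "J \<subseteq> {1..m}" for J
    using that
  proof induction
    case empty
    \<comment> \<open>Any vertex serves; for m = 0 this is the whole claim.\<close>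
    then show ?case using wg by (auto simp: weighted_graph_def)
  next
    case (insert k J)
    then have k: "k \<in> {1..m}" by simp
    obtain u where u: "u \<in> verts G" "\<forall>i\<in>J. comp i u = f i" using insert by auto
    obtain z where z: "z \<in> verts G" "f k = comp k z" using f[OF k] by (auto simp: verts_Q)
    obtain x where x: "(u, x) \<in> (adj (E k))\<^sup>*" "(x, z) \<in> conn k"
      using class_front[OF k u(1) z(1)] .
    have xv: "x \<in> verts G" using walk_in_verts[OF k x(1) u(1)] .
    have "comp i x = f i" if i: "i \<in> J" for i
    proof -
      have "(u, x) \<in> conn i" using i insert by (intro class_walk_conn[OF k _ _ x(1)]) auto
      then show ?thesis using u i xv component_eq_iff by metis
    qed
    moreover have "comp k x = f k" using x xv z component_eq_iff by metis
    ultimately show ?case using xv by auto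
  qed
  from this[of "{1..m}"] that show thesis by auto
qed

text \<open>The edge slides along the walk from \<open>a\<close> to \<open>u\<close>, one square per
  step. Its far end moves along the side opposite to that step, which lies in another class than
  \<open>E k\<close>, so the far end stays in its component.\<close>

lemma edge_transport:
  assumes k: "k \<in> {1..m}" and ab: "{a, b} \<in> E k" and au: "(a, u) \<in> conn k"
  shows "\<exists>d. {u, d} \<in> E k \<and> (b, d) \<in> conn k \<and> weight G {u, d} = weight G {a, b}"
  using au unfolding conn_def
proof induction
  case base
  show ?case using ab by blast
next
  case (step y z)
  then obtain d where d: "{y, d} \<in> E k" "(b, d) \<in> conn k" "weight G {y, d} = weight G {a, b}"
    unfolding conn_def by blast
  have yz: "{y, z} \<in> edges G" "{y, z} \<notin> E k" using step.hyps(2) by auto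
  then obtain j where j: "j \<in> {1..m}" "{y, z} \<in> E j" "j \<noteq> k"
    using class_cover by metis
  obtain x where x: "{d, x} \<in> E j" "{x, z} \<in> E k" "weight G {y, d} = weight G {x, z}"
    using square[of k j y d z] j k d(1) by auto
  have "(d, x) \<in> conn k" using j k x(1) conn_class by metis
  then have "{z, x} \<in> E k" "(b, x) \<in> conn k" "weight G {z, x} = weight G {a, b}"
    using d x conn_trans by (simp_all add: insert_commute)
  then show ?case unfolding conn_def by blast
qed

text \<open>Transporting \<open>{a, b}\<close> gives an edge \<open>{u, d}\<close> of
  \<open>E k\<close>. The vertices \<open>d\<close> and \<open>v\<close> agree in every component:
  for \<open>k\<close> both are linked to \<open>b\<close>, for other indices both are linked to
  \<open>u\<close>. Hence d = v.\<close>

lemma edge_lift: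
  assumes k: "k \<in> {1..m}" and uv: "u \<in> verts G" "v \<in> verts G"
    and others: "\<And>i. \<lbrakk>i \<in> {1..m}; i \<noteq> k\<rbrakk> \<Longrightarrow> (u, v) \<in> conn i"
    and ab: "{a, b} \<in> E k" "(a, u) \<in> conn k" "(b, v) \<in> conn k"
  shows "{u, v} \<in> E k" "weight G {u, v} = weight G {a, b}"
proof -
  obtain d where d: "{u, d} \<in> E k" "(b, d) \<in> conn k" "weight G {u, d} = weight G {a, b}"
    using edge_transport[OF k ab(1,2)] by blast
  have dv: "d \<in> verts G" using d(1) class_edge edge_verts k by blast
  have "d = v"
  proof (rule conn_all_eq[OF dv uv(2)])
    fix i assume i: "i \<in> {1..m}"
    show "(d, v) \<in> conn i"
    proof (cases "i = k")
      case True
      then show ?thesis using d ab conn_sym conn_trans by blast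
    next
      case False
      then have "(u, d) \<in> conn i" using conn_class d(1) i k by metis
      then show ?thesis using others[OF i False] conn_sym conn_trans by blast
    qed
  qed
  with d show "{u, v} \<in> E k" "weight G {u, v} = weight G {a, b}" by auto
qed

section \<open>The quotient graphs and the product\<close>

text \<open>Well-definedness of the definite description in \<open>quotient_graph\<close>:
  \<open>edge_lift\<close> shows that all edges between the two components have equal
  weight.\<close>

lemma weight_Q:
  assumes k: "k \<in> {1..m}" and ab: "{a, b} \<in> E k"
  shows "weight (Q k) {comp k a, comp k b} = weight G {a, b}"
proof -
  have abG: "{a, b} \<in> edges G" and ver: "a \<in> verts G" "b \<in> verts G"
    using class_edge[OF k ab] edge_verts by auto
  have same: "weight G {c, d} = weight G {a, b}"
    if c: "c \<in> comp k a" and d: "d \<in> comp k b" and cd: "{c, d} \<in> edges G" for c d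
  proof -
    have cd': "c \<in> verts G" "d \<in> verts G" "(a, c) \<in> conn k" "(b, d) \<in> conn k"
      using c d ver by (auto simp: component_eq)
    \<comment> \<open>An edge outside \<open>E k\<close> would merge the two components,
      contradicting \<open>class_separates\<close> for \<open>{a, b}\<close>.\<close>
    have "{c, d} \<in> E k"
    proof (rule ccontr)
      assume "{c, d} \<notin> E k"
      then have "(c, d) \<in> conn k" using cd by (intro conn_edge)
      then have "(a, b) \<in> conn k" using cd' conn_sym conn_trans by blast
      then show False using class_separates[OF k ab] by (simp add: conn_def)
    qed
    then show ?thesis
      using edge_lift(2)[OF k cd'(1,2) _ ab cd'(3,4)] conn_class k by metis
  qed
  have mem: "a \<in> comp k a" "b \<in> comp k b" using ver by (simp_all add: component_eq)
  show ?thesis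
    unfolding quotient_graph_def wgraph.simps
  proof (rule the_equality)
    show "\<forall>A B. {comp k a, comp k b} = {A, B} \<longrightarrow>
        (\<forall>a'\<in>A. \<forall>b'\<in>B. {a', b'} \<in> edges G \<longrightarrow> weight G {a', b'} = weight G {a, b})"
    proof (intro allI impI ballI)
      fix A B c d
      assume "{comp k a, comp k b} = {A, B}" "c \<in> A" "d \<in> B" "{c, d} \<in> edges G"
      \<comment> \<open>The unordered pair of components can be read in both orders, hence both
        instances of \<open>same\<close>.\<close>
      then show "weight G {c, d} = weight G {a, b}"
        using same[of c d] same[of d c] by (auto simp: doubleton_eq_iff insert_commute)
    qed
  next
    fix c
    assume "\<forall>A B. {comp k a, comp k b} = {A, B} \<longrightarrow>
        (\<forall>a'\<in>A. \<forall>b'\<in>B. {a', b'} \<in> edges G \<longrightarrow> weight G {a', b'} = c)"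
    \<comment> \<open>The edge \<open>{a, b}\<close> itself joins the two components and forces the
      value.\<close>
    then show "c = weight G {a, b}" using mem abG by blast
  qed
qed

lemma edge_Q:
  assumes k: "k \<in> {1..m}" and ab: "{a, b} \<in> E k"
  shows "{comp k a, comp k b} \<in> edges (Q k)"
proof -
  have ver: "a \<in> verts G" "b \<in> verts G"
    using class_edge[OF k ab] edge_verts by auto
  have "(a, b) \<notin> conn k" using class_separates[OF k ab] by (simp add: conn_def)
  then have "comp k a \<noteq> comp k b" using ver component_eq_iff by blast
  moreover have "a \<in> comp k a" "b \<in> comp k b" using ver by (simp_all add: component_eq)
  moreover have "comp k a \<in> verts (Q k)" "comp k b \<in> verts (Q k)"
    using ver by (simp_all add: verts_Q)
  ultimately show ?thesis
    using ab unfolding quotient_graph_def wgraph.simps by blast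
qed

lemma edge_Q_cases:
  assumes k: "k \<in> {1..m}" and e: "{A, B} \<in> edges (Q k)"
  obtains a b where "{a, b} \<in> E k" "A = comp k a" "B = comp k b" "A \<noteq> B"
proof -
  obtain A' B' a b where *: "{A, B} = {A', B'}" "A' \<in> verts (Q k)" "B' \<in> verts (Q k)" "A' \<noteq> B'"
    "a \<in> A'" "b \<in> B'" "{a, b} \<in> E k"
    using e unfolding quotient_graph_def wgraph.simps by blast
  have rep: "C = comp k c" if C: "C \<in> verts (Q k)" and c: "c \<in> C" for C c
  proof -
    obtain d where d: "d \<in> verts G" "C = comp k d" using C by (auto simp: verts_Q)
    then have "c \<in> verts G" "(d, c) \<in> conn k" using c by (auto simp: component_eq)
    then show ?thesis using d component_eq_iff by blast
  qed
  have "A' = comp k a" "B' = comp k b" using rep * by blast+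
  then show thesis
    using * that[of a b] that[of b a] by (auto simp: doubleton_eq_iff insert_commute)
qed

lemma weighted_graph_Q:
  assumes k: "k \<in> {1..m}"
  shows "weighted_graph (Q k)"
proof -
  have fin: "finite (verts (Q k))" and ne: "verts (Q k) \<noteq> {}"
    using wg by (auto simp: verts_Q weighted_graph_def)
  have ends: "\<exists>A\<in>verts (Q k). \<exists>B\<in>verts (Q k). A \<noteq> B \<and> e = {A, B}" if "e \<in> edges (Q k)" for e
    using that unfolding quotient_graph_def wgraph.simps by blast
  have pos: "weight (Q k) e > 0" if e: "e \<in> edges (Q k)" for e
  proof -
    obtain A B where "e = {A, B}" using ends[OF e] by blast
    with e obtain a b where ab: "{a, b} \<in> E k" "e = {comp k a, comp k b}"
      using edge_Q_cases[OF k] by metis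
    then have "weight (Q k) e = weight G {a, b}" using weight_Q[OF k] by simp
    then show ?thesis using wg ab class_edge[OF k] by (auto simp: weighted_graph_def)
  qed
  \<comment> \<open>Connectedness by projection: a step in \<open>E k\<close> becomes an edge of the
    quotient, and any other step stays within one component.\<close>
  have walk: "(comp k u, comp k v) \<in> (adj (edges (Q k)))\<^sup>*"
    if "(u, v) \<in> (adj (edges G))\<^sup>*" for u v
    using that
  proof induction
    case base
    show ?case by simp
  next
    case (step y z)
    have yz: "{y, z} \<in> edges G" using step.hyps(2) by simp
    show ?case
    proof (cases "{y, z} \<in> E k")
      case True
      then show ?thesis using step.IH edge_Q[OF k True]
        by (meson adj_iff rtrancl.rtrancl_into_rtrancl)
    next
      case False
      then have "comp k y = comp k z"
        using conn_edge yz edge_verts[OF yz] component_eq_iff by blast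
      with step.IH show ?thesis by simp
    qed
  qed
  have "\<exists>p. path_between (Q k) A p B" if "A \<in> verts (Q k)" "B \<in> verts (Q k)" for A B
  proof (rule rtrancl_imp_path_between)
    show "(A, B) \<in> (adj (edges (Q k)))\<^sup>*"
      using that walk walk_connected unfolding verts_Q by blast
    show "\<Union> (edges (Q k)) \<subseteq> verts (Q k)" using ends by blast
  qed (fact that(1))
  with fin ne ends pos show ?thesis unfolding weighted_graph_def by blast
qed

section \<open>The map \<open>alpha\<close> as an isomorphism\<close>

lemma product_step_alpha:
  assumes uv: "u \<in> verts G" "v \<in> verts G"
  shows "product_step {1..m} Q (alpha G m E u) (alpha G m E v) l \<longleftrightarrow> l \<in> {1..m} \<and> {u, v} \<in> E l"
proof (cases "l \<in> {1..m}")
  case l: True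
  have "product_step {1..m} Q (alpha G m E u) (alpha G m E v) l \<longleftrightarrow>
    {comp l u, comp l v} \<in> edges (Q l) \<and> (\<forall>i\<in>{1..m}. i \<noteq> l \<longrightarrow> (u, v) \<in> conn i)"
    using l uv unfolding product_step_def alpha_def by (auto simp: component_eq_iff)
  also have "\<dots> \<longleftrightarrow> {u, v} \<in> E l"
  proof (intro iffI conjI ballI impI)
    \<comment> \<open>An edge of the quotient comes from some edge of \<open>E l\<close> between the
      same components; agreement in the other coordinates lets \<open>edge_lift\<close> move it to
      \<open>u\<close> and \<open>v\<close>.\<close>
    assume *: "{comp l u, comp l v} \<in> edges (Q l) \<and> (\<forall>i\<in>{1..m}. i \<noteq> l \<longrightarrow> (u, v) \<in> conn i)"
    then obtain a b where ab: "{a, b} \<in> E l" "comp l u = comp l a" "comp l v = comp l b"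
      using edge_Q_cases[OF l] by metis
    have "a \<in> verts G" "b \<in> verts G" using class_edge[OF l ab(1)] edge_verts by auto
    then have "(a, u) \<in> conn l" "(b, v) \<in> conn l" using ab uv component_eq_iff by metis+
    then show "{u, v} \<in> E l" using edge_lift(1)[OF l uv _ ab(1)] * by blast
  next
    assume "{u, v} \<in> E l"
    then show "{comp l u, comp l v} \<in> edges (Q l)" by (rule edge_Q[OF l])
  next
    fix i assume "{u, v} \<in> E l" "i \<in> {1..m}" "i \<noteq> l"
    then show "(u, v) \<in> conn i" using conn_class l by metis
  qed
  finally show ?thesis using l by simp
next
  case False
  then show ?thesis unfolding product_step_def by blast
qed

lemma alpha_mem:
  assumes "u \<in> verts G"
  shows "alpha G m E u \<in> (\<Pi>\<^sub>E i\<in>{1..m}. verts (Q i))"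
  using assms by (auto simp: alpha_def verts_Q)

lemma alpha_edge_iff:
  assumes uv: "u \<in> verts G" "v \<in> verts G"
  shows "{u, v} \<in> edges G \<longleftrightarrow> {alpha G m E u, alpha G m E v} \<in> edges (cart_prod {1..m} Q)"
proof
  assume "{u, v} \<in> edges G"
  then obtain l where "l \<in> {1..m}" "{u, v} \<in> E l" using class_cover by blast
  \<comment> \<open>Disjointness of the classes makes the direction unique.\<close>
  then have "\<exists>!l. product_step {1..m} Q (alpha G m E u) (alpha G m E v) l"
    unfolding product_step_alpha[OF uv] using class_disjoint by blast
  then show "{alpha G m E u, alpha G m E v} \<in> edges (cart_prod {1..m} Q)"
    unfolding cart_prod_def wgraph.simps
    by (intro CollectI exI conjI) (rule refl alpha_mem[OF uv(1)] alpha_mem[OF uv(2)] | assumption)+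
next
  assume "{alpha G m E u, alpha G m E v} \<in> edges (cart_prod {1..m} Q)"
  then obtain x y l where "{alpha G m E u, alpha G m E v} = {x, y}" "product_step {1..m} Q x y l"
    unfolding cart_prod_def wgraph.simps by blast
  \<comment> \<open>The representation of the edge in the product may list its ends in either
    order.\<close>
  then have "product_step {1..m} Q (alpha G m E u) (alpha G m E v) l \<or>
      product_step {1..m} Q (alpha G m E v) (alpha G m E u) l"
    by (auto simp: doubleton_eq_iff)
  then show "{u, v} \<in> edges G"
    unfolding product_step_alpha[OF uv] product_step_alpha[OF uv(2,1)] insert_commute[of v u]
    using class_edge by blast
qed

lemma alpha_weight:
  assumes "{u, v} \<in> edges G"
  shows "weight G {u, v} = weight (cart_prod {1..m} Q) {alpha G m E u, alpha G m E v}"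
proof -
  obtain l where l: "l \<in> {1..m}" "{u, v} \<in> E l" using assms class_cover by blast
  then have "product_step {1..m} Q (alpha G m E u) (alpha G m E v) l"
    unfolding product_step_alpha[OF edge_verts(1,2)[OF assms]] by blast
  then have "weight (cart_prod {1..m} Q) {alpha G m E u, alpha G m E v} =
      weight (Q l) {alpha G m E u l, alpha G m E v l}"
    by (rule weight_cart_prod) (rule weighted_graph_Q)
  also have "\<dots> = weight G {u, v}"
    using l weight_Q by (simp add: alpha_def)
  finally show ?thesis by simp
qed

lemma bij_betw_alpha: "bij_betw (alpha G m E) (verts G) (verts (cart_prod {1..m} Q))"
proof -
  have "inj_on (alpha G m E) (verts G)"
  proof (rule inj_onI)
    fix u v assume uv: "u \<in> verts G" "v \<in> verts G" and eq: "alpha G m E u = alpha G m E v"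
    show "u = v"
    proof (rule conn_all_eq[OF uv])
      fix i assume "i \<in> {1..m}"
      with fun_cong[OF eq, of i] show "(u, v) \<in> conn i"
        using component_eq_iff[OF uv] by (simp add: alpha_def)
    qed
  qed
  moreover have "f \<in> alpha G m E ` verts G" if f: "f \<in> (\<Pi>\<^sub>E i\<in>{1..m}. verts (Q i))" for f
  proof -
    obtain u where u: "u \<in> verts G" "\<And>i. i \<in> {1..m} \<Longrightarrow> comp i u = f i"
      using vertex_with_components[of f] f by (auto simp: PiE_iff)
    have "f = alpha G m E u"
      by (rule PiE_ext[OF f alpha_mem[OF u(1)]]) (use u(2) in \<open>auto simp: alpha_def\<close>)
    with u show ?thesis by blast
  qed
  ultimately show ?thesis
    using alpha_mem unfolding bij_betw_def cart_prod_def by auto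
qed

lemma is_iso_alpha: "is_iso (alpha G m E) G (cart_prod {1..m} Q)"
  using bij_betw_alpha alpha_edge_iff alpha_weight unfolding is_iso_def by blast

end

text \<open>The only place where the locale assumptions are tied to distances. Injectivity of
  \<open>E\<close> turns distinct indices into distinct, hence disjoint, classes.\<close>

lemma (in wgraph) square_partition_theta_tau:
  assumes bij: "bij_betw E {1..m} (edges G // theta_tau_star G)"
  shows "square_partition G m E"
proof -
  note eq = equiv_theta_tau_star
  have cl: "E i \<in> edges G // theta_tau_star G" if "i \<in> {1..m}" for i
    using bij that by (metis bij_betwE)
  have neq: "E i \<noteq> E j" if "i \<in> {1..m}" "j \<in> {1..m}" "i \<noteq> j" for i j
    using bij that by (meson bij_betw_imp_inj_on inj_onD)
  have cover: "\<exists>i\<in>{1..m}. e \<in> E i" if "e \<in> edges G" for e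
  proof -
    have "e \<in> \<Union>(edges G // theta_tau_star G)" using that Union_quotient[OF eq] by simp
    then show ?thesis using bij by (auto simp: bij_betw_def)
  qed
  show ?thesis
  proof
    show "E i \<subseteq> edges G" if "i \<in> {1..m}" for i
      using cl[OF that] eq by (metis in_quotient_imp_subset)
    show "\<exists>i\<in>{1..m}. e \<in> E i" if "e \<in> edges G" for e
      using that by (rule cover)
    show "e \<notin> E j" if "i \<in> {1..m}" "j \<in> {1..m}" "i \<noteq> j" "e \<in> E i" for i j e
      using quotient_disj[OF eq cl[OF that(1)] cl[OF that(2)]] neq[OF that(1-3)] that(4) by blast
    show "\<exists>x. {v, x} \<in> E j \<and> {x, v'} \<in> E i \<and> weight G {u, v} = weight G {x, v'}"
      if "i \<in> {1..m}" "j \<in> {1..m}" "i \<noteq> j" "{u, v} \<in> E i" "{u, v'} \<in> E j" for i j u v v'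
      using class_square[OF cl[OF that(1)] cl[OF that(2)] neq[OF that(1-3)] that(4,5)] by metis
    show "(u, v) \<notin> (adj (edges G - E i))\<^sup>*" if "i \<in> {1..m}" "{u, v} \<in> E i" for i u v
    \<comment> \<open>The separating edge is \<open>{u, v}\<close> itself.\<close>
    proof (rule theta_separates[OF cl[OF that(1)] that(2)])
      have "{u, v} \<in> edges G"
        using cl[OF that(1)] that(2) eq by (meson in_quotient_imp_subset subsetD)
      then show "gdist G u u - gdist G u v \<noteq> gdist G v u - gdist G v v"
        by (rule theta_refl)
    qed
    show "\<exists>i\<in>{1..m}. (u, v) \<notin> (adj (edges G - E i))\<^sup>*"
      if uv: "u \<in> verts G" "v \<in> verts G" "u \<noteq> v" for u v
    proof -
      \<comment> \<open>The class to delete is that of any edge \<open>{a, b}\<close> whose distance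
        difference tells \<open>u\<close> and \<open>v\<close> apart.\<close>
      obtain a b where ab: "{a, b} \<in> edges G"
        "gdist G u a - gdist G u b \<noteq> gdist G v a - gdist G v b"
        using distinct_verts_separated[OF uv] by blast
      then obtain i where "i \<in> {1..m}" "{a, b} \<in> E i" using cover by blast
      with ab show ?thesis using theta_separates[OF cl] by blast
    qed
  qed
qed

theorem theorem4p6:
  fixes G :: "'a wgraph" and m :: nat and E :: "nat \<Rightarrow> 'a set set"
  assumes "weighted_graph G"
    and "bij_betw E {1..m} (edges G // theta_tau_star G)"
  shows "(\<forall>u\<in>verts G. \<forall>v\<in>verts G. u \<noteq> v \<longrightarrow>
            ({u, v} \<in> edges G \<longleftrightarrow>
               {alpha G m E u, alpha G m E v}
                 \<in> edges (cart_prod {1..m} (\<lambda>i. quotient_graph G (E i)))) \<and>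
            ({u, v} \<in> edges G \<longrightarrow>
               weight G {u, v} =
               weight (cart_prod {1..m} (\<lambda>i. quotient_graph G (E i)))
                 {alpha G m E u, alpha G m E v}))
         \<and> factorization {1..m} (\<lambda>i. quotient_graph G (E i)) G"
proof -
  interpret wgraph G using assms(1) by unfold_locales
  interpret square_partition G m E using assms(2) by (rule square_partition_theta_tau)
  show ?thesis
    using alpha_edge_iff alpha_weight is_iso_alpha weighted_graph_Q
    unfolding factorization_def isomorphic_def by blast
qed

end
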